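(* Let $n\geq 2$, let $\Omega\subseteq\mathbb{R}^n$ be an open set, and let $f,g\in C^\infty(\Omega)$ be smooth real-valued functions with simple zeros and a common zero set $\Sigma_f=\Sigma_g$. Then there exists a non-vanishing smooth real-valued function $\varphi\in C^\infty(\Omega)$ such that $f=g\varphi$ on $\Omega$.
   Context: For $f\colon\Omega\to\mathbb{R}$, the zero set is $\Sigma_f=\{\mathbf{a}\in\Omega : f(\mathbf{a})=0\}$. A smooth function $f\colon\Omega\to\mathbb{R}$ is said to have simple zeros if $\nabla f|_{\mathbf{a}}\neq 0$ for all $\mathbf{a}\in\Sigma_f$. Non-vanishing means nonzero at every point of the domain. *)

theory Defs
  imports "HOL-Analysis.Analysis"
begin

text \<open>
  Functions are total on the type, and only their values on the domain matter. The
  following recursion means continuous differentiability of order \<open>k\<close> for open \<open>S\<close> and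
  finite-dimensional \<open>'a\<close>: \<open>f\<close> is Frechet differentiable on \<open>S\<close> and all its directional
  derivatives are of order \<open>k - 1\<close>. The derivative is the unrestricted one, \<open>at x\<close>, which
  at a point of an open set depends only on the values of \<open>f\<close> in that set.
\<close>

primrec Ck_on :: "nat \<Rightarrow> 'a::euclidean_space set \<Rightarrow> ('a \<Rightarrow> 'b::real_normed_vector) \<Rightarrow> bool" where
  "Ck_on 0 S f \<longleftrightarrow> continuous_on S f"
| "Ck_on (Suc k) S f \<longleftrightarrow>
     (\<forall>x\<in>S. f differentiable (at x)) \<and>
     (\<forall>v. Ck_on k S (\<lambda>x. frechet_derivative f (at x) v))"

definition smooth_on :: "'a::euclidean_space set \<Rightarrow> ('a \<Rightarrow> 'b::real_normed_vector) \<Rightarrow> bool" where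
  "smooth_on S f \<longleftrightarrow> (\<forall>k. Ck_on k S f)"

definition gradient :: "(real ^ 'n \<Rightarrow> real) \<Rightarrow> real ^ 'n \<Rightarrow> real ^ 'n" where
  "gradient f a = (\<chi> i. frechet_derivative f (at a) (axis i 1))"

lemma gradient_eq_if_GDERIV:
  assumes "GDERIV f a :> D"
  shows "gradient f a = D"
proof -
  have "frechet_derivative f (at a) = (\<lambda>h. h \<bullet> D)"
    using assms frechet_derivative_at unfolding gderiv_def by metis
  then show ?thesis
    by (simp add: gradient_def vec_eq_iff inner_axis')
qed

lemma GDERIV_gradient:
  assumes "f differentiable (at a)"
  shows "GDERIV f a :> gradient f a"
proof -
  let ?D = "frechet_derivative f (at a)"
  have d: "(f has_derivative ?D) (at a)"
    using assms frechet_derivative_works by blast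
  then have l: "linear ?D"
    by (rule has_derivative_linear)
  have "?D h = h \<bullet> gradient f a" for h
  proof -
    have "?D h = ?D (\<Sum>i\<in>UNIV. (h $ i) *\<^sub>R axis i 1)"
      using basis_expansion[of h] by (simp add: scalar_mult_eq_scaleR)
    also have "\<dots> = (\<Sum>i\<in>UNIV. (h $ i) * ?D (axis i 1))"
      using l by (simp add: linear_sum linear_cmul)
    finally show ?thesis
      by (simp add: gradient_def inner_vec_def)
  qed
  then have "?D = (\<lambda>h. h \<bullet> gradient f a)"
    by blast
  then show ?thesis
    using d unfolding gderiv_def by simp
qed

definition zero_set :: "'a set \<Rightarrow> ('a \<Rightarrow> real) \<Rightarrow> 'a set" where
  "zero_set \<Omega> f = {a \<in> \<Omega>. f a = 0}"

definition simple_zeros :: "(real ^ 'n) set \<Rightarrow> (real ^ 'n \<Rightarrow> real) \<Rightarrow> bool" where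
  "simple_zeros \<Omega> f \<longleftrightarrow> (\<forall>a \<in> zero_set \<Omega> f. gradient f a \<noteq> 0)"

definition non_vanishing_on :: "'a set \<Rightarrow> ('a \<Rightarrow> real) \<Rightarrow> bool" where
  "non_vanishing_on \<Omega> f \<longleftrightarrow> (\<forall>a \<in> \<Omega>. f a \<noteq> 0)"

end

theory Submission
  imports Defs
begin

text \<open>
  Away from the common zero set the quotient \<open>f / g\<close> is smooth and nonzero, so the only question
  is its behaviour near a common zero \<open>a\<close>. There \<open>g\<close> can serve as a coordinate: for a unit vector
  \<open>v\<close> with \<open>\<partial>\<^sub>v g(a) \<noteq> 0\<close>, the map \<open>\<Phi> x = x + (g x - x \<bullet> v) v\<close> replaces the \<open>v\<close>-coordinate of
  \<open>x\<close> by \<open>g x\<close> and is a local diffeomorphism (\<open>smooth_inverse_of_straightening\<close>). In the new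
  coordinates \<open>g\<close> becomes the linear form \<open>y \<mapsto> y \<bullet> v\<close>, and \<open>u = f \<circ> \<Phi>\<inverse>\<close> vanishes on its kernel.
  Hadamard's lemma (\<open>smooth_division_by_linear_form\<close>) factors such a \<open>u\<close> as
  \<open>u y = (y \<bullet> v) h y\<close> with \<open>h y = \<integral>\<^sub>0\<^sup>1 \<partial>\<^sub>v u (y - t (y \<bullet> v) v) dt\<close>, which is smooth by
  differentiation under the integral. Pulling back gives \<open>f = g (h \<circ> \<Phi>)\<close> near \<open>a\<close>.

  The local quotients fit together because each of them is forced: off the zero set it is
  \<open>f / g\<close>, and at a zero the product rule gives \<open>\<nabla>f = h \<nabla>g\<close>, which determines \<open>h\<close> since
  \<open>\<nabla>g \<noteq> 0\<close>. The same equation shows that the quotient does not vanish at a zero, since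
  \<open>\<nabla>f \<noteq> 0\<close>. The rest is the calculus of \<open>C\<^sup>k\<close> functions. Its basic rules are inductions
  on \<open>k\<close> in which the formula for the derivative is built from functions covered by the induction
  hypothesis.
\<close>

section \<open>Calculus of functions of class \<open>C\<^sup>k\<close>\<close>

lemma Ck_on_cong:
  assumes "open S" "\<And>x. x \<in> S \<Longrightarrow> f x = g x" "Ck_on k S f"
  shows "Ck_on k S g"
  using assms(2,3)
proof (induction k arbitrary: f g)
  case 0
  then show ?case by (simp cong: continuous_on_cong)
next
  case (Suc k)
  have g: "(g has_derivative frechet_derivative f (at x)) (at x)" if "x \<in> S" for x
    using Suc.prems that assms(1) frechet_derivative_works has_derivative_transform_within_open
    by (metis (no_types, lifting) Ck_on.simps(2))
  have "Ck_on k S (\<lambda>x. frechet_derivative g (at x) v)" for v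
  proof (rule Suc.IH)
    show "frechet_derivative f (at x) v = frechet_derivative g (at x) v" if "x \<in> S" for x
      using frechet_derivative_at[OF g[OF that]] by simp
    show "Ck_on k S (\<lambda>x. frechet_derivative f (at x) v)"
      using Suc.prems by simp
  qed
  moreover have "g differentiable (at x)" if "x \<in> S" for x
    using g[OF that] by (rule differentiableI)
  ultimately show ?case by simp
qed

text \<open>
  The workhorse of the inductions below: any explicit formula for the derivative may stand in for
  the derivative that the recursion chooses.
\<close>

lemma Ck_on_SucI:
  assumes "open S" "\<And>x. x \<in> S \<Longrightarrow> (f has_derivative f' x) (at x)"
    and "\<And>v. Ck_on k S (\<lambda>x. f' x v)"
  shows "Ck_on (Suc k) S f"
proof -
  have "Ck_on k S (\<lambda>x. frechet_derivative f (at x) v)" for v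
    by (rule Ck_on_cong[OF assms(1) _ assms(3)[of v]]) (simp add: frechet_derivative_at[OF assms(2)])
  moreover have "f differentiable (at x)" if "x \<in> S" for x
    using assms(2)[OF that] by (rule differentiableI)
  ultimately show ?thesis by simp
qed

lemma Ck_on_Suc_has_derivative:
  assumes "Ck_on (Suc k) S f" "x \<in> S"
  shows "(f has_derivative frechet_derivative f (at x)) (at x)"
  using assms frechet_derivative_works by auto

lemma Ck_on_SucD: "Ck_on (Suc k) S f \<Longrightarrow> Ck_on k S f"
proof (induction k arbitrary: f)
  case 0
  then show ?case
    by (auto intro!: continuous_at_imp_continuous_on differentiable_imp_continuous_within)
next
  case (Suc k)
  then show ?case by (metis Ck_on.simps(2))
qed

lemma Ck_on_imp_continuous_on: "Ck_on k S f \<Longrightarrow> continuous_on S f"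
  by (induction k) (use Ck_on_SucD in auto)

lemma Ck_on_subset: "Ck_on k S f \<Longrightarrow> T \<subseteq> S \<Longrightarrow> Ck_on k T f"
  by (induction k arbitrary: f) (auto intro: continuous_on_subset)

lemma Ck_on_local:
  assumes "\<And>x. x \<in> S \<Longrightarrow> \<exists>T. open T \<and> x \<in> T \<and> Ck_on k T f"
  shows "Ck_on k S f"
  using assms
proof (induction k arbitrary: f)
  case 0
  then show ?case
    by (metis Ck_on.simps(1) continuous_at_imp_continuous_on continuous_on_eq_continuous_at)
next
  case (Suc k)
  show ?case
    unfolding Ck_on.simps
  proof (intro conjI ballI allI)
    show "f differentiable at x" if "x \<in> S" for x
      using Suc.prems[OF that] by auto
    show "Ck_on k S (\<lambda>x. frechet_derivative f (at x) v)" for v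
      by (rule Suc.IH) (metis Suc.prems Ck_on.simps(2))
  qed
qed

lemma Ck_on_const [simp]: "Ck_on k S (\<lambda>x. c)"
  by (induction k arbitrary: c) auto

lemma Ck_on_bounded_linear:
  assumes "bounded_linear A" "open S" "Ck_on k S f"
  shows "Ck_on k S (\<lambda>x. A (f x))"
  using assms(3)
proof (induction k arbitrary: f)
  case 0
  then show ?case using assms(1) by (simp add: bounded_linear.continuous_on)
next
  case (Suc k)
  show ?case
  proof (rule Ck_on_SucI[OF assms(2)])
    show "((\<lambda>x. A (f x)) has_derivative (\<lambda>v. A (frechet_derivative f (at x) v))) (at x)"
      if "x \<in> S" for x
      using bounded_linear.has_derivative[OF assms(1) Ck_on_Suc_has_derivative[OF Suc.prems that]] .
    show "Ck_on k S (\<lambda>x. A (frechet_derivative f (at x) v))" for v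
      using Suc by simp
  qed
qed

lemma Ck_on_ident:
  assumes "open S"
  shows "Ck_on k S (\<lambda>x. x)"
proof (cases k)
  case (Suc m)
  show ?thesis
    unfolding Suc by (rule Ck_on_SucI[OF assms]) (auto intro: has_derivative_ident)
qed simp

lemma Ck_on_add:
  assumes "open S" "Ck_on k S f" "Ck_on k S g"
  shows "Ck_on k S (\<lambda>x. f x + g x)"
  using assms(2,3)
proof (induction k arbitrary: f g)
  case 0
  then show ?case by (simp add: continuous_on_add)
next
  case (Suc k)
  show ?case
  proof (rule Ck_on_SucI[OF assms(1)])
    show "((\<lambda>x. f x + g x) has_derivative
        (\<lambda>v. frechet_derivative f (at x) v + frechet_derivative g (at x) v)) (at x)"
      if "x \<in> S" for x
      using has_derivative_add[OF Ck_on_Suc_has_derivative[OF Suc.prems(1) that]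
          Ck_on_Suc_has_derivative[OF Suc.prems(2) that]] .
  qed (use Suc in simp)
qed

lemma Ck_on_sum:
  assumes "open S" "finite I" "\<And>i. i \<in> I \<Longrightarrow> Ck_on k S (f i)"
  shows "Ck_on k S (\<lambda>x. \<Sum>i\<in>I. f i x)"
  using assms(2,3) by (induction I) (auto intro!: Ck_on_add assms(1))

lemma Ck_on_scaleR:
  fixes f :: "'a::euclidean_space \<Rightarrow> real"
  assumes "open S" "Ck_on k S f" "Ck_on k S g"
  shows "Ck_on k S (\<lambda>x. f x *\<^sub>R g x)"
  using assms(2,3)
proof (induction k arbitrary: f g)
  case 0
  then show ?case by (simp add: continuous_on_scaleR)
next
  case (Suc k)
  show ?case
  proof (rule Ck_on_SucI[OF assms(1)])
    show "((\<lambda>x. f x *\<^sub>R g x) has_derivative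
        (\<lambda>v. f x *\<^sub>R frechet_derivative g (at x) v + frechet_derivative f (at x) v *\<^sub>R g x)) (at x)"
      if "x \<in> S" for x
      using has_derivative_scaleR[OF Ck_on_Suc_has_derivative[OF Suc.prems(1) that]
          Ck_on_Suc_has_derivative[OF Suc.prems(2) that]] .
    have "Ck_on k S f" "Ck_on k S g"
      using Suc.prems Ck_on_SucD by blast+
    then show "Ck_on k S (\<lambda>x. f x *\<^sub>R frechet_derivative g (at x) v
        + frechet_derivative f (at x) v *\<^sub>R g x)" for v
      using Suc.prems by (intro Ck_on_add[OF assms(1)] Suc.IH) auto
  qed
qed

lemma Ck_on_mult:
  fixes f g :: "'a::euclidean_space \<Rightarrow> real"
  assumes "open S" "Ck_on k S f" "Ck_on k S g"
  shows "Ck_on k S (\<lambda>x. f x * g x)"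
  using Ck_on_scaleR[OF assms] by simp

lemma Ck_on_inverse:
  fixes f :: "'a::euclidean_space \<Rightarrow> real"
  assumes "open S" "Ck_on k S f" "\<And>x. x \<in> S \<Longrightarrow> f x \<noteq> 0"
  shows "Ck_on k S (\<lambda>x. inverse (f x))"
  using assms(2)
proof (induction k)
  case 0
  then show ?case using assms(3) by (simp add: continuous_on_inverse)
next
  case (Suc k)
  have inv: "Ck_on k S (\<lambda>x. inverse (f x))"
    using Suc Ck_on_SucD by blast
  show ?case
  proof (rule Ck_on_SucI[OF assms(1)])
    show "((\<lambda>x. inverse (f x)) has_derivative
        (\<lambda>v. (-1) * (inverse (f x) * (frechet_derivative f (at x) v * inverse (f x))))) (at x)"
      if "x \<in> S" for x
      using Deriv.has_derivative_inverse[OF assms(3)[OF that] Ck_on_Suc_has_derivative[OF Suc.prems that]]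
      by (simp add: mult.assoc)
    show "Ck_on k S (\<lambda>x. (-1) * (inverse (f x) * (frechet_derivative f (at x) v * inverse (f x))))" for v
      by (intro Ck_on_mult assms(1) inv Ck_on_const) (use Suc.prems in auto)
  qed
qed

lemma Ck_on_divide:
  fixes f g :: "'a::euclidean_space \<Rightarrow> real"
  assumes "open S" "Ck_on k S f" "Ck_on k S g" "\<And>x. x \<in> S \<Longrightarrow> g x \<noteq> 0"
  shows "Ck_on k S (\<lambda>x. f x / g x)"
  using Ck_on_mult[OF assms(1,2) Ck_on_inverse[OF assms(1,3,4)]] by (simp add: field_simps)

text \<open>
  The chain rule is expanded along a basis of the intermediate space. Each derivative of \<open>g \<circ> f\<close>
  then becomes a finite sum of products of derivatives of \<open>f\<close> in a fixed direction and of
  derivatives of \<open>g\<close> in a fixed direction composed with \<open>f\<close>. The induction therefore varies \<open>g\<close> and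
  keeps \<open>f\<close>.
\<close>

lemma Ck_on_compose:
  fixes f :: "'a::euclidean_space \<Rightarrow> 'b::euclidean_space"
  assumes "open S" "open T" "f ` S \<subseteq> T" "Ck_on k S f" "Ck_on k T g"
  shows "Ck_on k S (\<lambda>x. g (f x))"
  using assms(4,5)
proof (induction k arbitrary: g)
  case 0
  then show ?case using assms(3) by (auto intro: continuous_on_compose2)
next
  case (Suc k)
  let ?Df = "\<lambda>x. frechet_derivative f (at x)" and ?Dg = "\<lambda>y. frechet_derivative g (at y)"
  show ?case
  proof (rule Ck_on_SucI[OF assms(1)])
    show "((\<lambda>x. g (f x)) has_derivative
        (\<lambda>v. \<Sum>b\<in>Basis. (?Df x v \<bullet> b) *\<^sub>R ?Dg (f x) b)) (at x)" if "x \<in> S" for x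
    proof -
      have f: "(f has_derivative ?Df x) (at x)"
        using Ck_on_Suc_has_derivative[OF Suc.prems(1) that] .
      have g: "(g has_derivative ?Dg (f x)) (at (f x))"
        using Ck_on_Suc_has_derivative[OF Suc.prems(2)] that assms(3) by blast
      have lin: "linear (?Dg (f x))"
        using g by (rule has_derivative_linear)
      have "?Dg (f x) (?Df x v) = (\<Sum>b\<in>Basis. (?Df x v \<bullet> b) *\<^sub>R ?Dg (f x) b)" for v
      proof -
        have "?Dg (f x) (?Df x v) = ?Dg (f x) (\<Sum>b\<in>Basis. (?Df x v \<bullet> b) *\<^sub>R b)"
          by (simp add: euclidean_representation)
        also have "\<dots> = (\<Sum>b\<in>Basis. (?Df x v \<bullet> b) *\<^sub>R ?Dg (f x) b)"
          using lin by (simp add: linear_sum linear_cmul)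
        finally show ?thesis .
      qed
      then show ?thesis
        using has_derivative_compose[OF f g] by simp
    qed
    show "Ck_on k S (\<lambda>x. \<Sum>b\<in>Basis. (?Df x v \<bullet> b) *\<^sub>R ?Dg (f x) b)" for v
    proof (intro Ck_on_sum Ck_on_scaleR assms(1) finite_Basis)
      fix b :: 'b
      show "Ck_on k S (\<lambda>x. ?Df x v \<bullet> b)"
        using Suc.prems(1) by (intro Ck_on_bounded_linear[OF bounded_linear_inner_left assms(1)]) simp
      show "Ck_on k S (\<lambda>x. ?Dg (f x) b)"
        using Suc.prems(2) Ck_on_SucD[OF Suc.prems(1)] by (intro Suc.IH) auto
    qed
  qed
qed

section \<open>Smooth division by a linear form\<close>

text \<open>
  Differentiating \<open>w (y + t A y)\<close> in \<open>y\<close> along \<open>h\<close> produces \<open>\<partial>\<^sub>h w\<close> and, with an extra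
  factor \<open>t\<close>, \<open>\<partial>\<^bsub>A h\<^esub> w\<close>. Both are integrals of the same shape with a \<open>w\<close> of lower order; the
  weight \<open>c\<close> is there to absorb the factor, so that the induction closes.
\<close>

lemma Ck_on_integral_along_linear:
  fixes w :: "'a::euclidean_space \<Rightarrow> real" and c :: "real \<Rightarrow> real"
  assumes "open V" "convex V" and A: "bounded_linear A"
    and inV: "\<And>y t. y \<in> V \<Longrightarrow> t \<in> cbox 0 1 \<Longrightarrow> y + t *\<^sub>R A y \<in> V"
    and "continuous_on (cbox 0 1) c" "Ck_on k V w"
  shows "Ck_on k V (\<lambda>y. integral (cbox 0 1) (\<lambda>t. c t * w (y + t *\<^sub>R A y)))"
  using assms(5,6)
proof (induction k arbitrary: c w)
  case 0
  then have contw: "continuous_on V w" by simp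
  have [continuous_intros]: "continuous_on X (\<lambda>z. A (h z))" if "continuous_on X h"
    for X :: "('a \<times> real) set" and h
    using bounded_linear.continuous_on[OF A that] .
  have "continuous_on (V \<times> cbox 0 1) (\<lambda>(y, t). c t * w (y + t *\<^sub>R A y))"
    unfolding split_beta
    by (intro continuous_intros continuous_on_compose2[OF 0(1)]
        continuous_on_compose2[OF contw]) (use inV in auto)
  from integral_continuous_on_param[OF this] show ?case by simp
next
  case (Suc k)
  let ?Dw = "\<lambda>y. frechet_derivative w (at y)"
  have [continuous_intros]: "continuous_on X (\<lambda>z. A (h z))" if "continuous_on X h"
    for X :: "('a \<times> real) set" and h
    using bounded_linear.continuous_on[OF A that] .
  have [continuous_intros]: "continuous_on X (\<lambda>z. A (h z))" if "continuous_on X h"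
    for X :: "real set" and h
    using bounded_linear.continuous_on[OF A that] .
  have contw: "continuous_on V w"
    using Ck_on_imp_continuous_on Suc.prems(2) by blast
  have contDw: "continuous_on V (\<lambda>y. ?Dw y b)" for b
    using Ck_on_imp_continuous_on Suc.prems(2) by (metis Ck_on.simps(2))
  have linDw: "linear (?Dw y)" if "y \<in> V" for y
    using Ck_on_Suc_has_derivative[OF Suc.prems(2) that] by (rule has_derivative_linear)
  let ?D = "\<lambda>y t h. c t * ?Dw (y + t *\<^sub>R A y) (h + t *\<^sub>R A h)"
  \<comment> \<open>The Leibniz rule needs the derivative as a continuous family of bounded operators.\<close>
  define fx where "fx y t = Blinfun (?D y t)" for y t
  have der: "((\<lambda>y. c t * w (y + t *\<^sub>R A y)) has_derivative ?D y t) (at y)"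
    if "y \<in> V" "t \<in> cbox 0 1" for y t
  proof -
    have 1: "((\<lambda>y. y + t *\<^sub>R A y) has_derivative (\<lambda>h. h + t *\<^sub>R A h)) (at y)"
      by (intro derivative_intros bounded_linear.has_derivative[OF A])
    show ?thesis
      using has_derivative_compose[OF 1 Ck_on_Suc_has_derivative[OF Suc.prems(2) inV[OF that]]]
      by (rule has_derivative_mult_right)
  qed
  have fx: "blinfun_apply (fx y t) = ?D y t" if "y \<in> V" "t \<in> cbox 0 1" for y t
    unfolding fx_def using der[OF that] by (intro bounded_linear_Blinfun_apply) (rule has_derivative_bounded_linear)
  have split: "?D y t h = c t * ?Dw (y + t *\<^sub>R A y) h + (c t * t) * ?Dw (y + t *\<^sub>R A y) (A h)"
    if "y \<in> V" "t \<in> cbox 0 1" for y t h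
    using linDw[OF inV[OF that]] by (simp add: linear_add linear_cmul algebra_simps)
  have contD: "continuous_on (V \<times> cbox 0 1)
      (\<lambda>(y, t). c t * ?Dw (y + t *\<^sub>R A y) h + (c t * t) * ?Dw (y + t *\<^sub>R A y) (A h))" for h
    unfolding split_beta
    by (intro continuous_intros continuous_on_compose2[OF Suc.prems(1)]
        continuous_on_compose2[OF contDw]) (use inV in auto)
  have contfx: "continuous_on (V \<times> cbox 0 1) (\<lambda>(y, t). fx y t)"
    unfolding split_beta
  proof (rule continuous_on_blinfun_componentwise)
    fix i :: 'a
    show "continuous_on (V \<times> cbox 0 1) (\<lambda>z. blinfun_apply (fx (fst z) (snd z)) i)"
      using contD[of i] by (rule continuous_on_eq) (auto simp: fx split)
  qed
  have line: "continuous_on (cbox 0 1) (\<lambda>t. q (y + t *\<^sub>R A y))"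
    if "continuous_on V q" "y \<in> V" for y and q :: "'a \<Rightarrow> real"
    by (rule continuous_on_compose2[OF that(1)]) (use inV that in \<open>auto intro!: continuous_intros\<close>)
  have "((\<lambda>y. integral (cbox 0 1) (\<lambda>t. c t * w (y + t *\<^sub>R A y))) has_derivative
      (\<lambda>h. integral (cbox 0 1) (\<lambda>t. c t * ?Dw (y + t *\<^sub>R A y) h)
         + integral (cbox 0 1) (\<lambda>t. (c t * t) * ?Dw (y + t *\<^sub>R A y) (A h)))) (at y)"
    if y: "y \<in> V" for y
  proof -
    have "((\<lambda>y. integral (cbox 0 1) (\<lambda>t. c t * w (y + t *\<^sub>R A y))) has_derivative
        blinfun_apply (integral (cbox 0 1) (fx y))) (at y within V)"
    proof (rule leibniz_rule[OF _ _ contfx y \<open>convex V\<close>])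
      show "((\<lambda>y. c t * w (y + t *\<^sub>R A y)) has_derivative blinfun_apply (fx x t)) (at x within V)"
        if "x \<in> V" "t \<in> cbox 0 1" for x t
        using der[OF that] fx[OF that] has_derivative_at_withinI by metis
      show "(\<lambda>t. c t * w (x + t *\<^sub>R A x)) integrable_on cbox 0 1" if "x \<in> V" for x
        by (intro integrable_continuous continuous_on_mult Suc.prems(1) line contw that)
    qed
    moreover have "blinfun_apply (integral (cbox 0 1) (fx y)) h
        = integral (cbox 0 1) (\<lambda>t. c t * ?Dw (y + t *\<^sub>R A y) h)
         + integral (cbox 0 1) (\<lambda>t. (c t * t) * ?Dw (y + t *\<^sub>R A y) (A h))" for h
    proof -
      have "continuous_on (cbox 0 1) (\<lambda>t. (y, t))"
        by (intro continuous_on_Pair continuous_on_const continuous_on_id)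
      from continuous_on_compose2[OF contfx this] have "continuous_on (cbox 0 1) (fx y)"
        using y by auto
      then have "blinfun_apply (integral (cbox 0 1) (fx y)) h
          = integral (cbox 0 1) (\<lambda>t. blinfun_apply (fx y t) h)"
        by (intro blinfun_apply_integral integrable_continuous)
      also have "\<dots> = integral (cbox 0 1) (\<lambda>t. c t * ?Dw (y + t *\<^sub>R A y) h
          + (c t * t) * ?Dw (y + t *\<^sub>R A y) (A h))"
        using y by (intro integral_cong) (simp only: fx split)
      also have "\<dots> = integral (cbox 0 1) (\<lambda>t. c t * ?Dw (y + t *\<^sub>R A y) h)
         + integral (cbox 0 1) (\<lambda>t. (c t * t) * ?Dw (y + t *\<^sub>R A y) (A h))"
        by (intro integral_add integrable_continuous continuous_on_mult Suc.prems(1)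
            line contDw y continuous_on_id)
      finally show ?thesis .
    qed
    ultimately show ?thesis
      using at_within_open[OF y \<open>open V\<close>] by (metis (no_types, lifting) ext)
  qed
  then show ?case
  proof (rule Ck_on_SucI[OF \<open>open V\<close>])
    fix h
    show "Ck_on k V (\<lambda>y. integral (cbox 0 1) (\<lambda>t. c t * ?Dw (y + t *\<^sub>R A y) h)
         + integral (cbox 0 1) (\<lambda>t. (c t * t) * ?Dw (y + t *\<^sub>R A y) (A h)))"
      using Suc.prems by (intro Ck_on_add[OF \<open>open V\<close>] Suc.IH continuous_intros) auto
  qed
qed

text \<open>
  Hadamard's lemma. The hypothesis on projections keeps the segment from \<open>y\<close> to its projection onto
  the hyperplane \<open>y \<bullet> v = 0\<close> inside \<open>V\<close>. Along this segment \<open>u\<close> runs from \<open>u y\<close> to \<open>0\<close>, with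
  velocity \<open>- (y \<bullet> v) \<partial>\<^sub>v u\<close>, and the constant factor can be taken out of the integral.
\<close>

lemma smooth_division_by_linear_form:
  fixes u :: "'a::euclidean_space \<Rightarrow> real"
  assumes "open V" "convex V"
    and proj: "\<And>y. y \<in> V \<Longrightarrow> y - (y \<bullet> v) *\<^sub>R v \<in> V"
    and u: "smooth_on V u" and v: "norm v = 1"
    and zero: "\<And>y. y \<in> V \<Longrightarrow> y \<bullet> v = 0 \<Longrightarrow> u y = 0"
  shows "\<exists>h. smooth_on V h \<and> (\<forall>y\<in>V. u y = (y \<bullet> v) * h y)"
proof -
  define A where "A y = - (y \<bullet> v) *\<^sub>R v" for y
  define h where "h y = integral (cbox 0 1) (\<lambda>t. 1 * frechet_derivative u (at (y + t *\<^sub>R A y)) v)" for y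
    \<comment> \<open>The factor \<open>1\<close> is the weight of the preceding lemma.\<close>
  have A: "bounded_linear A"
    unfolding A_def
    by (intro bounded_linear_scaleR_const bounded_linear_minus bounded_linear_inner_left)
  have inV: "y + t *\<^sub>R A y \<in> V" if "y \<in> V" "t \<in> cbox 0 1" for y t
  proof -
    have "(1 - t) *\<^sub>R y + t *\<^sub>R (y - (y \<bullet> v) *\<^sub>R v) \<in> V"
      using \<open>convex V\<close> that proj[OF that(1)] by (intro convexD) auto
    then show ?thesis
      by (simp add: A_def algebra_simps)
  qed
  have Ck: "Ck_on (Suc k) V u" for k
    using u unfolding smooth_on_def by blast
  have "smooth_on V h"
    unfolding smooth_on_def h_def
  proof
    fix k
    show "Ck_on k V (\<lambda>y. integral (cbox 0 1)
        (\<lambda>t. 1 * frechet_derivative u (at (y + t *\<^sub>R A y)) v))"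
      using Ck[of k] by (intro Ck_on_integral_along_linear[OF \<open>open V\<close> \<open>convex V\<close> A inV]) auto
  qed
  moreover have "u y = (y \<bullet> v) * h y" if y: "y \<in> V" for y
  proof -
    have der: "((\<lambda>t. u (y + t *\<^sub>R A y)) has_vector_derivative
        - (y \<bullet> v) * frechet_derivative u (at (y + t *\<^sub>R A y)) v) (at t within {0..1})"
      if "t \<in> {0..1}" for t
    proof -
      have du: "(u has_derivative frechet_derivative u (at (y + t *\<^sub>R A y))) (at (y + t *\<^sub>R A y))"
        using Ck_on_Suc_has_derivative[OF Ck inV] y that by auto
      have "((\<lambda>t. y + t *\<^sub>R A y) has_derivative (\<lambda>s. s *\<^sub>R A y)) (at t within {0..1})"
        by (auto intro!: derivative_eq_intros)
      from has_derivative_compose[OF this du] show ?thesis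
        unfolding has_vector_derivative_def A_def
        using has_derivative_linear[OF du] by (simp add: linear_cmul linear_neg A_def mult_ac)
    qed
    have "((\<lambda>t. - (y \<bullet> v) * frechet_derivative u (at (y + t *\<^sub>R A y)) v) has_integral
        u (y + 1 *\<^sub>R A y) - u (y + 0 *\<^sub>R A y)) {0..1}"
      using der by (intro fundamental_theorem_of_calculus) auto
    moreover have "u (y + 1 *\<^sub>R A y) = 0"
    proof (rule zero)
      show "y + 1 *\<^sub>R A y \<in> V" using inV[OF y, of 1] by simp
      show "(y + 1 *\<^sub>R A y) \<bullet> v = 0"
        using v by (simp add: A_def algebra_simps norm_eq_1)
    qed
    ultimately have "- u y = integral {0..1} (\<lambda>t. - (y \<bullet> v) * frechet_derivative u (at (y + t *\<^sub>R A y)) v)"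
      by (metis add.right_neutral diff_0 integral_unique scaleR_zero_left)
    also have "\<dots> = - (y \<bullet> v) * h y"
      unfolding h_def by (subst integral_mult_right) simp
    finally show ?thesis by simp
  qed
  ultimately show ?thesis by blast
qed

section \<open>Straightening a regular zero set\<close>

text \<open>
  The inverse function theorem only provides a differentiable inverse \<open>\<Psi>\<close>. Its smoothness follows by
  bootstrapping: \<open>D\<Phi>(x)\<close> is inverted by the explicit formula
  \<open>k \<mapsto> k + ((k \<bullet> v - Dg(x) k) / Dg(x) v) v\<close>, so \<open>D\<Psi>(y)\<close> is a smooth expression evaluated at
  \<open>x = \<Psi> y\<close>, and it is \<open>C\<^sup>k\<close> as soon as \<open>\<Psi>\<close> is.
\<close>

lemma smooth_inverse_of_straightening:
  fixes g :: "'a::euclidean_space \<Rightarrow> real"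
  assumes "open S" "a \<in> S" and g: "smooth_on S g"
    and v: "norm v = 1" and nz: "\<And>x. x \<in> S \<Longrightarrow> frechet_derivative g (at x) v \<noteq> 0"
  defines "\<Phi> \<equiv> \<lambda>x. x + (g x - x \<bullet> v) *\<^sub>R v"
  obtains U V \<Psi> where "open U" "a \<in> U" "U \<subseteq> S" "open V" "homeomorphism U V \<Phi> \<Psi>" "smooth_on V \<Psi>"
proof -
  have vv [simp]: "v \<bullet> v = 1"
    using v by (simp add: norm_eq_1)
  let ?Dg = "\<lambda>x. frechet_derivative g (at x)"
  let ?D = "\<lambda>x h. h + (?Dg x h - h \<bullet> v) *\<^sub>R v"
  let ?E = "\<lambda>x k. k + ((k \<bullet> v - ?Dg x k) / ?Dg x v) *\<^sub>R v"
  have Ck: "Ck_on k S g" for k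
    using g unfolding smooth_on_def by blast
  have dg: "(g has_derivative ?Dg x) (at x)" if "x \<in> S" for x
    using Ck_on_Suc_has_derivative[OF Ck that] .
  have lin: "linear (?Dg x)" if "x \<in> S" for x
    using dg[OF that] by (rule has_derivative_linear)
  have der: "(\<Phi> has_derivative ?D x) (at x)" if "x \<in> S" for x
    unfolding \<Phi>_def by (intro derivative_intros dg that)
  have Dg_E: "?Dg x (?E x k) = k \<bullet> v" and Dg_D: "?Dg x (?D x k) = ?Dg x k + (?Dg x k - k \<bullet> v) * ?Dg x v"
    if "x \<in> S" for x k
    using lin[OF that] nz[OF that] by (simp_all only: linear_add linear_cmul) simp_all
  have DE: "?D x (?E x k) = k" if "x \<in> S" for x k
    unfolding Dg_E[OF that] by (simp add: inner_add_left)
  have ED: "?E x (?D x k) = k" if "x \<in> S" for x k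
  proof -
    have "(?D x k \<bullet> v - ?Dg x (?D x k)) / ?Dg x v = - (?Dg x k - k \<bullet> v)"
      unfolding Dg_D[OF that] using nz[OF that] by (simp add: inner_add_left)
    then show ?thesis
      by (simp only: scaleR_minus_left add.assoc right_minus add_0_right)
  qed
  define F where "F x = Blinfun (?D x)" for x
  have F: "blinfun_apply (F x) = ?D x" if "x \<in> S" for x
    unfolding F_def using der[OF that]
    by (intro bounded_linear_Blinfun_apply) (rule has_derivative_bounded_linear)
  have der_F: "(\<Phi> has_derivative blinfun_apply (F x)) (at x)" if "x \<in> S" for x
    unfolding F[OF that] by (rule der[OF that])
  have contF: "continuous_on S F"
  proof (rule continuous_on_blinfun_componentwise)
    fix i :: 'a
    have "continuous_on S (\<lambda>x. ?Dg x i)"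
      using Ck_on_imp_continuous_on Ck[of "Suc 0"] by (metis Ck_on.simps(2))
    then have "continuous_on S (\<lambda>x. ?D x i)"
      by (intro continuous_intros)
    then show "continuous_on S (\<lambda>x. blinfun_apply (F x) i)"
      by (rule continuous_on_eq) (simp add: F)
  qed
  have "bounded_linear (\<lambda>k. k \<bullet> v - ?Dg a k)"
    using has_derivative_bounded_linear[OF dg[OF \<open>a \<in> S\<close>]]
    by (intro bounded_linear_sub bounded_linear_inner_left)
  from bounded_linear_compose[OF bounded_linear_divide this, of "?Dg a v"]
  have "bounded_linear (?E a)"
    by (intro bounded_linear_add bounded_linear_ident bounded_linear_scaleR_const)
  then have E: "blinfun_apply (Blinfun (?E a)) = ?E a"
    by (rule bounded_linear_Blinfun_apply)
  have left_inverse: "Blinfun (?E a) o\<^sub>L F a = id_blinfun"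
    by (intro blinfun_eqI) (simp only: blinfun_apply_blinfun_compose E F[OF \<open>a \<in> S\<close>]
        ED[OF \<open>a \<in> S\<close>] blinfun_apply_id_blinfun)
  obtain U V \<Psi> \<Psi>' where UV: "open U" "U \<subseteq> S" "a \<in> U" "open V" "homeomorphism U V \<Phi> \<Psi>"
    and d\<Psi>: "\<And>y. y \<in> V \<Longrightarrow> (\<Psi> has_derivative \<Psi>' y) (at y)"
    and \<Psi>': "\<And>y. y \<in> V \<Longrightarrow> \<Psi>' y = inv (blinfun_apply (F (\<Psi> y)))"
    by (rule inverse_function_theorem[OF \<open>open S\<close> der_F contF \<open>a \<in> S\<close> left_inverse])
      (assumption, rule that)
  have \<Psi>S: "\<Psi> ` V \<subseteq> S"
    using UV by (auto simp: homeomorphism_def)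
  have \<Psi>'_eq: "\<Psi>' y = ?E (\<Psi> y)" if "y \<in> V" for y
  proof -
    have "\<Psi> y \<in> S" using that \<Psi>S by blast
    then have "inv (?D (\<Psi> y)) = ?E (\<Psi> y)"
      by (intro inv_unique_comp) (auto simp only: o_def DE ED id_def)
    then show ?thesis
      using \<Psi>' that F \<open>\<Psi> y \<in> S\<close> by simp
  qed
  have "Ck_on k V \<Psi>" for k
  proof (induction k)
    case 0
    then show ?case using UV by (simp add: homeomorphism_def)
  next
    case (Suc k)
    show ?case
    proof (rule Ck_on_SucI[OF \<open>open V\<close>])
      show "(\<Psi> has_derivative ?E (\<Psi> y)) (at y)" if "y \<in> V" for y
        using d\<Psi> \<Psi>'_eq that by metis
      fix w
      have D: "Ck_on k S (\<lambda>x. ?Dg x u)" for u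
        using Ck[of "Suc k"] by simp
      have "Ck_on k S (\<lambda>x. w + ((w \<bullet> v + (- 1) * ?Dg x w) / ?Dg x v) *\<^sub>R v)"
        by (intro Ck_on_add Ck_on_scaleR Ck_on_divide Ck_on_mult Ck_on_const D \<open>open S\<close> nz)
      from Ck_on_compose[OF \<open>open V\<close> \<open>open S\<close> \<Psi>S Suc this]
      show "Ck_on k V (\<lambda>y. ?E (\<Psi> y) w)" by simp
    qed
  qed
  then show ?thesis
    using UV that unfolding smooth_on_def by blast
qed

text \<open>
  The factorization is carried out in the straightened coordinates on a ball \<open>B\<close> centred at
  \<open>\<Phi> a\<close>. As \<open>g a = 0\<close>, the centre lies on the hyperplane \<open>y \<bullet> v = 0\<close>, and so the orthogonal
  projection onto that hyperplane maps \<open>B\<close> into itself, as Hadamard's lemma demands.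
\<close>

lemma smooth_on_divide_near_regular_zero:
  fixes f g :: "'a::euclidean_space \<Rightarrow> real"
  assumes "open S" "a \<in> S" and f: "smooth_on S f" and g: "smooth_on S g"
    and "g a = 0" and D: "frechet_derivative g (at a) w \<noteq> 0"
    and zero: "\<And>x. x \<in> S \<Longrightarrow> g x = 0 \<Longrightarrow> f x = 0"
  obtains U h where "open U" "a \<in> U" "U \<subseteq> S" "smooth_on U h" "\<And>x. x \<in> U \<Longrightarrow> f x = g x * h x"
proof -
  let ?Dg = "\<lambda>x. frechet_derivative g (at x)"
  have Ckg: "Ck_on k S g" and Ckf: "Ck_on k S f" for k
    using f g unfolding smooth_on_def by blast+
  have lin: "linear (?Dg a)"
    using Ck_on_Suc_has_derivative[OF Ckg \<open>a \<in> S\<close>] by (rule has_derivative_linear)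
  have "w \<noteq> 0"
    using D lin by (metis linear_0)
  define v where "v = w /\<^sub>R norm w"
  have v: "norm v = 1" and Dv: "?Dg a v \<noteq> 0"
    using \<open>w \<noteq> 0\<close> D lin by (simp_all add: v_def linear_cmul)
  \<comment> \<open>Straightening along \<open>v\<close> requires the derivative in this one direction not to vanish anywhere.\<close>
  define S' where "S' = {x \<in> S. ?Dg x v \<noteq> 0}"
  have "continuous_on S (\<lambda>x. ?Dg x v)"
    using Ck_on_imp_continuous_on Ckg[of "Suc 0"] by (metis Ck_on.simps(2))
  then have "open (S \<inter> (\<lambda>x. ?Dg x v) -` (- {0}))"
    by (intro continuous_open_preimage \<open>open S\<close>) auto
  moreover have "S' = S \<inter> (\<lambda>x. ?Dg x v) -` (- {0})"
    unfolding S'_def by auto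
  ultimately have S': "open S'" "a \<in> S'" "S' \<subseteq> S"
    using \<open>a \<in> S\<close> Dv by (auto simp: S'_def)
  define \<Phi> where "\<Phi> = (\<lambda>x. x + (g x - x \<bullet> v) *\<^sub>R v)"
  have nz: "?Dg x v \<noteq> 0" if "x \<in> S'" for x
    using that by (simp add: S'_def)
  have "smooth_on S' g"
    using Ckg S' Ck_on_subset unfolding smooth_on_def by blast
  then obtain U V \<Psi> where UV: "open U" "a \<in> U" "U \<subseteq> S'" "open V"
    and hom: "homeomorphism U V \<Phi> \<Psi>" and \<Psi>: "smooth_on V \<Psi>"
    using smooth_inverse_of_straightening[OF S'(1,2) _ v nz, folded \<Phi>_def] by blast
  have \<Phi>v: "\<Phi> x \<bullet> v = g x" for x
    using v by (simp add: \<Phi>_def norm_eq_1 inner_add_left)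
  have "\<Phi> a \<in> V"
    using hom UV by (auto simp: homeomorphism_def)
  then obtain r where "r > 0" and B: "ball (\<Phi> a) r \<subseteq> V"
    using \<open>open V\<close> open_contains_ball by blast
  define B where "B = ball (\<Phi> a) r"
  have B_iff: "y \<in> B \<longleftrightarrow> norm (y - \<Phi> a) < r" for y
    by (simp add: B_def dist_norm norm_minus_commute)
  have proj: "y - (y \<bullet> v) *\<^sub>R v \<in> B" if "y \<in> B" for y
  proof -
    let ?z = "y - \<Phi> a"
    have "\<Phi> a \<bullet> v = 0" using \<Phi>v \<open>g a = 0\<close> by simp
    then have "(y - (y \<bullet> v) *\<^sub>R v) - \<Phi> a = ?z - (?z \<bullet> v) *\<^sub>R v"
      by (simp add: algebra_simps)
    moreover have "norm (?z - (?z \<bullet> v) *\<^sub>R v) \<le> norm ?z"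
    proof -
      have "(norm (?z - (?z \<bullet> v) *\<^sub>R v))\<^sup>2 = (norm ?z)\<^sup>2 - (?z \<bullet> v)\<^sup>2"
        using v unfolding power2_norm_eq_inner norm_eq_1
        by (simp add: inner_diff_left inner_diff_right inner_commute power2_eq_square algebra_simps)
      then show ?thesis
        by (intro power2_le_imp_le[OF _ norm_ge_zero]) simp
    qed
    ultimately have "norm ((y - (y \<bullet> v) *\<^sub>R v) - \<Phi> a) < r"
      using that le_less_trans unfolding B_iff by metis
    then show ?thesis unfolding B_iff .
  qed
  have "\<Psi> ` V = U"
    using hom by (simp add: homeomorphism_def)
  then have \<Psi>S: "\<Psi> ` B \<subseteq> S"
    using UV(3) S'(3) B unfolding B_def by blast
  have "Ck_on k B (\<lambda>y. f (\<Psi> y))" for k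
  proof (rule Ck_on_compose[OF _ \<open>open S\<close> \<Psi>S _ Ckf])
    show "open B" by (simp add: B_def)
    show "Ck_on k B \<Psi>"
      using \<Psi> Ck_on_subset B unfolding smooth_on_def B_def by blast
  qed
  then have "smooth_on B (\<lambda>y. f (\<Psi> y))"
    unfolding smooth_on_def by blast
  moreover have "f (\<Psi> y) = 0" if "y \<in> B" "y \<bullet> v = 0" for y
  proof (rule zero)
    show "\<Psi> y \<in> S" using \<Psi>S that by blast
    have "\<Phi> (\<Psi> y) = y" using hom that B by (auto simp: homeomorphism_def B_def)
    then show "g (\<Psi> y) = 0" using \<Phi>v[of "\<Psi> y"] that by simp
  qed
  moreover have "open B" "convex B"
    by (simp_all add: B_def)
  ultimately obtain h where h: "smooth_on B h" and fh: "\<forall>y\<in>B. f (\<Psi> y) = (y \<bullet> v) * h y"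
    using smooth_division_by_linear_form[of B v "\<lambda>y. f (\<Psi> y)", OF _ _ proj _ v] by blast
  define U' where "U' = U \<inter> \<Phi> -` B"
  have "continuous_on U \<Phi>"
    using hom by (simp add: homeomorphism_def)
  then have U': "open U'" "a \<in> U'" "U' \<subseteq> S"
    using UV S' \<open>r > 0\<close> by (auto simp: U'_def B_def intro!: continuous_open_preimage)
  have "Ck_on k U' (\<lambda>x. h (\<Phi> x))" for k
  proof (rule Ck_on_compose[OF U'(1), of B])
    show "open B" "\<Phi> ` U' \<subseteq> B" by (auto simp: B_def U'_def)
    show "Ck_on k B h" using h by (simp add: smooth_on_def)
    have "Ck_on k U' (\<lambda>x. x + (g x + (- 1) * (x \<bullet> v)) *\<^sub>R v)"
      by (intro Ck_on_add Ck_on_scaleR Ck_on_mult Ck_on_const Ck_on_ident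
          Ck_on_bounded_linear[OF bounded_linear_inner_left] U'(1) Ck_on_subset[OF Ckg U'(3)])
    then show "Ck_on k U' \<Phi>" by (simp add: \<Phi>_def)
  qed
  then have "smooth_on U' (\<lambda>x. h (\<Phi> x))"
    unfolding smooth_on_def by blast
  moreover have "f x = g x * h (\<Phi> x)" if "x \<in> U'" for x
  proof -
    have "\<Psi> (\<Phi> x) = x" using hom that by (auto simp: homeomorphism_def U'_def)
    then show ?thesis using fh that \<Phi>v[of x] by (force simp: U'_def)
  qed
  ultimately show ?thesis
    using that U' by blast
qed

section \<open>Gluing the local quotients\<close>

text \<open>
  In the product rule for \<open>g h\<close> the term with the gradient of \<open>h\<close> carries the factor \<open>g a = 0\<close>.
  Where the gradient of \<open>g\<close> is nonzero, the two gradients thus determine the value at \<open>a\<close> of every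
  smooth quotient.
\<close>

lemma gradient_mult_at_zero:
  assumes "open U" "a \<in> U" "smooth_on U g" "smooth_on U h" "g a = 0"
    and "\<And>x. x \<in> U \<Longrightarrow> f x = g x * h x"
  shows "gradient f a = h a *\<^sub>R gradient g a"
proof -
  have g: "(g has_derivative frechet_derivative g (at a)) (at a)"
    and h: "(h has_derivative frechet_derivative h (at a)) (at a)"
    using Ck_on_Suc_has_derivative assms(2-4) unfolding smooth_on_def by blast+
  have "((\<lambda>x. g x * h x) has_derivative (\<lambda>v. h a * frechet_derivative g (at a) v)) (at a)"
    using has_derivative_mult[OF g h] \<open>g a = 0\<close> by (simp add: mult.commute)
  then have "(f has_derivative (\<lambda>v. h a * frechet_derivative g (at a) v)) (at a)"
    by (rule has_derivative_transform_within_open[OF _ assms(1,2)]) (simp add: assms(6))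
  then have "frechet_derivative f (at a) v = h a * frechet_derivative g (at a) v" for v
    by (simp flip: frechet_derivative_at)
  then show ?thesis
    by (simp add: gradient_def vec_eq_iff)
qed

theorem theorem2:
  fixes \<Omega> :: "(real ^ 'n) set" and f g :: "real ^ 'n \<Rightarrow> real"
  assumes "CARD('n) \<ge> 2"
    and "open \<Omega>"
    and "smooth_on \<Omega> f" and "smooth_on \<Omega> g"
    and "simple_zeros \<Omega> f" and "simple_zeros \<Omega> g"
    and "zero_set \<Omega> f = zero_set \<Omega> g"
  shows "\<exists>\<phi> :: real ^ 'n \<Rightarrow> real.
           smooth_on \<Omega> \<phi> \<and> non_vanishing_on \<Omega> \<phi> \<and> (\<forall>x \<in> \<Omega>. f x = g x * \<phi> x)"
proof -
  \<comment> \<open>The value at a zero is the solution \<open>c\<close> of \<open>gradient f x = c *\<^sub>R gradient g x\<close>.\<close>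
  define \<phi> where "\<phi> x = (if g x = 0 then (gradient f x \<bullet> gradient g x) / (gradient g x \<bullet> gradient g x)
      else f x / g x)" for x
  have zeros: "f x = 0 \<longleftrightarrow> g x = 0" if "x \<in> \<Omega>" for x
    using assms(7) that unfolding zero_set_def by blast
  have grad: "gradient f x \<noteq> 0" "gradient g x \<noteq> 0" if "x \<in> \<Omega>" "g x = 0" for x
    using assms(5,6) that zeros unfolding simple_zeros_def zero_set_def by auto
  have local_quotient: "\<exists>U h. open U \<and> a \<in> U \<and> U \<subseteq> \<Omega> \<and> smooth_on U h \<and> (\<forall>x\<in>U. f x = g x * h x)"
    if a: "a \<in> \<Omega>" "g a = 0" for a
  proof -
    obtain i where "frechet_derivative g (at a) (axis i 1) \<noteq> 0"
      using grad(2)[OF a] by (auto simp: gradient_def vec_eq_iff)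
    then show ?thesis
      using smooth_on_divide_near_regular_zero[OF assms(2) a(1) assms(3,4) a(2)] zeros by metis
  qed
  have agree: "\<phi> x = h x" and grad_eq: "g x = 0 \<longrightarrow> gradient f x = h x *\<^sub>R gradient g x"
    if U: "open U" "U \<subseteq> \<Omega>" "smooth_on U h" "\<forall>x\<in>U. f x = g x * h x" and x: "x \<in> U" for U h x
  proof -
    have "smooth_on U g"
      using assms(4) U(2) Ck_on_subset unfolding smooth_on_def by blast
    then show "g x = 0 \<longrightarrow> gradient f x = h x *\<^sub>R gradient g x"
      using gradient_mult_at_zero[OF U(1) x _ U(3)] U(4) by blast
    then show "\<phi> x = h x"
      using U x grad(2)[of x] by (auto simp: \<phi>_def)
  qed
  have nonzero: "\<phi> x \<noteq> 0" if "x \<in> \<Omega>" for x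
  proof (cases "g x = 0")
    case True
    obtain U h where U: "open U" "x \<in> U" "U \<subseteq> \<Omega>" "smooth_on U h" "\<forall>x\<in>U. f x = g x * h x"
      using local_quotient[OF \<open>x \<in> \<Omega>\<close> True] by blast
    show ?thesis
      using agree[OF U(1,3,4,5,2)] grad_eq[OF U(1,3,4,5,2)] True grad(1)[OF that] by auto
  next
    case False
    then show ?thesis using zeros[OF that] by (simp add: \<phi>_def)
  qed
  have "Ck_on k \<Omega> \<phi>" for k
  proof (rule Ck_on_local)
    fix x assume x: "x \<in> \<Omega>"
    show "\<exists>T. open T \<and> x \<in> T \<and> Ck_on k T \<phi>"
    proof (cases "g x = 0")
      case True
      obtain U h where U: "open U" "x \<in> U" "U \<subseteq> \<Omega>" "smooth_on U h" "\<forall>x\<in>U. f x = g x * h x"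
        using local_quotient[OF x True] by blast
      have "Ck_on k U \<phi>"
      proof (rule Ck_on_cong[OF U(1)])
        show "h y = \<phi> y" if "y \<in> U" for y
          using agree[OF U(1,3,4,5) that] by simp
        show "Ck_on k U h"
          using U(4) by (simp add: smooth_on_def)
      qed
      then show ?thesis using U by blast
    next
      case False
      let ?T = "\<Omega> \<inter> g -` (- {0})"
      have "continuous_on \<Omega> g"
        using assms(4) Ck_on_imp_continuous_on unfolding smooth_on_def by blast
      then have T: "open ?T"
        by (intro continuous_open_preimage assms(2)) auto
      have "Ck_on k ?T (\<lambda>x. f x / g x)"
        using assms(3,4) unfolding smooth_on_def
        by (intro Ck_on_divide T) (auto intro: Ck_on_subset)
      then have "Ck_on k ?T \<phi>"
        by (rule Ck_on_cong[OF T, rotated]) (simp add: \<phi>_def)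
      then show ?thesis using T x False by blast
    qed
  qed
  moreover have "f x = g x * \<phi> x" if "x \<in> \<Omega>" for x
    using zeros[OF that] by (simp add: \<phi>_def)
  ultimately show ?thesis
    using nonzero unfolding smooth_on_def non_vanishing_on_def by blast
qed

end
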